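(* Assume that $A_0^i$ and $A_{22}^i$ are Hurwitz for all $i\in\mathcal I$, and let $\gamma_{11}\le1$. Then for all unbounded sequences $(t_k)_{k\ge0}$ of event times, and for all sequences $(\sigma_k)_{k\ge0}$ in $\mathcal I$ and $(\nu_k)_{k\ge1}$ in $\mathcal J$, the reduced order system $$\dot x(t)=A_0^{\sigma_k}x(t),\ t\in[t_k,t_{k+1}),\ k\in\mathbb N,\qquad x(t_k)=R_{11}^{\sigma_{k-1}\stackrel{\nu_k}{\to}\sigma_k}x(t_k^-),\ k\ge1,$$ with state $x(t)\in\mathbb R^{n_x}$, is globally asymptotically stable.
   Context: Setting. Let $n_x,n_z\ge1$, $n=n_x+n_z$, let $\varepsilon>0$ be a parameter and $\mathcal I,\mathcal J$ finite nonempty index sets. For each $i\in\mathcal I$, $\mathbf D^i$ is an $n\times n$ diagonal matrix with $n_z$ diagonal entries equal to $\varepsilon$ and the other $n_x$ equal to $1$ (positions may depend on $i$), and $S_i$ is a permutation matrix with $S_i\mathbf D^iS_i^\top=\mathrm{diag}(I_{n_x},\varepsilon I_{n_z})$. Let $\mathbf A^i\in\mathbb R^{n\times n}$ ($i\in\mathcal I$) and $\mathbf J^j\in\mathbb R^{n\times n}$ ($j\in\mathcal J$) be given (independent of $\varepsilon$), and set $A^i=S_i\mathbf A^iS_i^\top$, $J^{i\stackrel{j}{\to}i'}=S_{i'}\mathbf J^jS_i^\top$ for $i,i'\in\mathcal I$, $j\in\mathcal J$. Write $A^i=\begin{pmatrix} A^i_{11} & A^i_{12} \\ A^i_{21} &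 A^i_{22} \end{pmatrix}$ and $J^{i\stackrel{j}{\to}i'}=\begin{pmatrix} J_{11}^{i\stackrel{j}{\to}i'} & J_{12}^{i\stackrel{j}{\to}i'} \\ J_{21}^{i\stackrel{j}{\to}i'} & J_{22}^{i\stackrel{j}{\to}i'} \end{pmatrix}$ in blocks of sizes $n_x,n_z$, with $A_{22}^i$ non-singular. Set $$A_0^i=A_{11}^i-A_{12}^i(A_{22}^i)^{-1}A_{21}^i,\qquad R_{11}^{i\stackrel{j}{\to}i'}=J_{11}^{i\stackrel{j}{\to}i'}-J_{12}^{i\stackrel{j}{\to}i'}(A_{22}^i)^{-1}A_{21}^i.$$ A sequence of event times is a strictly increasing sequence $0=t_0<t_1<\cdots$; $x(t_k^-)$ denotes the left limit. Globally asymptotically stable means: the origin is Lyapunov stable (for every $\rho>0$ there is $\delta>0$ such that initial states at time $0$ of norm $<\delta$ give solutions of norm $<\rho$ for all $t\ge0$) and every solution tends to $0$ as $t\to\infty$. Constants. Since the $A_0^i$ are Hurwitz, fix symmetric matrices $Q_s^i\ge I_{n_x}$ and numbers $\lambda_s^i>0$ with $A_0^{i\top}Q_s^i+Q_s^iA_0^i\le-2\lambda_s^iQ_s^i$ for all $i\in\mathcal I$. With $\|\cdot\|$ the spectral norm, put $$\gamma_{11}=\max_{i,i'\in\mathcal I,\,j\in\mathcal J}\|(Q_s^{i'})^{1/2}R_{11}^{i\stackrel{j}{\to}i'}(Q_s^i)^{-1/2}\|.$$ *)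

theory Defs
  imports "HOL-Analysis.Analysis"
begin

(* Matrices of size n = n_x + n_z are indexed by the sum type 'x + 'z: the indices Inl a are the
   first n_x ones and the indices Inr b are the last n_z ones. *)

definition block11 :: "'a^('x::finite + 'z::finite)^('x+'z) \<Rightarrow> 'a^'x^'x" where
  "block11 M = (\<chi> a b. M $ Inl a $ Inl b)"

definition block12 :: "'a^('x::finite + 'z::finite)^('x+'z) \<Rightarrow> 'a^'z^'x" where
  "block12 M = (\<chi> a b. M $ Inl a $ Inr b)"

definition block21 :: "'a^('x::finite + 'z::finite)^('x+'z) \<Rightarrow> 'a^'x^'z" where
  "block21 M = (\<chi> a b. M $ Inr a $ Inl b)"

definition block22 :: "'a^('x::finite + 'z::finite)^('x+'z) \<Rightarrow> 'a^'z^'z" where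
  "block22 M = (\<chi> a b. M $ Inr a $ Inr b)"

definition diag_matrix :: "('n \<Rightarrow> real) \<Rightarrow> real^'n^'n" where
  "diag_matrix d = (\<chi> a b. if a = b then d a else 0)"

(* The positions of the entries eps are given by a set Z, so that the definition also makes
   sense when eps = 1. *)
definition is_eps_diagonal :: "real \<Rightarrow> real^('x::finite + 'z::finite)^('x+'z) \<Rightarrow> bool" where
  "is_eps_diagonal eps D \<longleftrightarrow>
     (\<exists>Z. card Z = CARD('z) \<and> D = diag_matrix (\<lambda>a. if a \<in> Z then eps else 1))"

definition permutation_matrix :: "real^'n::finite^'n \<Rightarrow> bool" where
  "permutation_matrix S \<longleftrightarrow>
     (\<exists>p. p permutes UNIV \<and> S = (\<chi> a b. if b = p a then 1 else 0))"

definition complex_eigenvalue :: "real^'n::finite^'n \<Rightarrow> complex \<Rightarrow> bool" where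
  "complex_eigenvalue M c \<longleftrightarrow> (\<exists>v. v \<noteq> 0 \<and> map_matrix of_real M *v v = c *s v)"

definition hurwitz :: "real^'n::finite^'n \<Rightarrow> bool" where
  "hurwitz M \<longleftrightarrow> (\<forall>c. complex_eigenvalue M c \<longrightarrow> Re c < 0)"

definition symmetric_matrix :: "real^'n::finite^'n \<Rightarrow> bool" where
  "symmetric_matrix M \<longleftrightarrow> transpose M = M"

definition psd_matrix :: "real^'n::finite^'n \<Rightarrow> bool" where
  "psd_matrix M \<longleftrightarrow> symmetric_matrix M \<and> (\<forall>x. 0 \<le> x \<bullet> (M *v x))"

(* The order on symmetric matrices; the order on real^'n^'n in the library is entrywise. *)
definition loewner_le :: "real^'n::finite^'n \<Rightarrow> real^'n^'n \<Rightarrow> bool" where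
  "loewner_le M N \<longleftrightarrow> psd_matrix (N - M)"

(* The unique positive semidefinite square root; only meaningful for positive semidefinite M. *)
definition psd_sqrt :: "real^'n::finite^'n \<Rightarrow> real^'n^'n" where
  "psd_sqrt M = (THE B. psd_matrix B \<and> B ** B = M)"

(* norm on real^'n is the Euclidean one. *)
definition spectral_norm :: "real^'n::finite^'m::finite \<Rightarrow> real" where
  "spectral_norm M = onorm (\<lambda>x. M *v x)"

definition reduced_flow :: "real^('x::finite + 'z::finite)^('x+'z) \<Rightarrow> real^'x^'x" where
  "reduced_flow A = block11 A - block12 A ** matrix_inv (block22 A) ** block21 A"

definition reduced_jump :: "real^('x::finite + 'z::finite)^('x+'z) \<Rightarrow> real^('x+'z)^('x+'z) \<Rightarrow> real^'x^'x" where
  "reduced_jump A J = block11 J - block12 J ** matrix_inv (block22 A) ** block21 A"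

(* R i j i' is the matrix of the jump from mode i to mode i' with label j. *)
definition gamma11 ::
    "('i::finite \<Rightarrow> real^'x^'x) \<Rightarrow> ('i \<Rightarrow> 'j::finite \<Rightarrow> 'i \<Rightarrow> real^'x^'x) \<Rightarrow> real" where
  "gamma11 Q R =
     Max {spectral_norm (psd_sqrt (Q i') ** R i j i' ** matrix_inv (psd_sqrt (Q i))) | i j i'. True}"

definition event_times :: "(nat \<Rightarrow> real) \<Rightarrow> bool" where
  "event_times t \<longleftrightarrow> t 0 = 0 \<and> strict_mono t"

(* At the left end point t k of an interval, the derivative is the right derivative. The values of
   nu at 0 and of x at negative times are irrelevant. *)
definition switched_solution ::
    "('i \<Rightarrow> real^'x^'x) \<Rightarrow> ('i \<Rightarrow> 'j \<Rightarrow> 'i \<Rightarrow> real^'x^'x) \<Rightarrow>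
     (nat \<Rightarrow> real) \<Rightarrow> (nat \<Rightarrow> 'i) \<Rightarrow> (nat \<Rightarrow> 'j) \<Rightarrow> (real \<Rightarrow> real^'x) \<Rightarrow> bool" where
  "switched_solution F R t \<sigma> \<nu> x \<longleftrightarrow>
     (\<forall>k. \<forall>s\<in>{t k..<t (Suc k)}.
        (x has_vector_derivative F (\<sigma> k) *v x s) (at s within {t k..<t (Suc k)})) \<and>
     (\<forall>k\<ge>1. \<exists>l. (x \<longlongrightarrow> l) (at_left (t k)) \<and>
        x (t k) = R (\<sigma> (k - 1)) (\<nu> k) (\<sigma> k) *v l)"

definition globally_asymptotically_stable :: "(real \<Rightarrow> 'a::real_normed_vector) set \<Rightarrow> bool" where
  "globally_asymptotically_stable X \<longleftrightarrow>
     (\<forall>\<rho>>0. \<exists>\<delta>>0. \<forall>x\<in>X. norm (x 0) < \<delta> \<longrightarrow> (\<forall>s\<ge>0. norm (x s) < \<rho>)) \<and>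
     (\<forall>x\<in>X. (x \<longlongrightarrow> 0) at_top)"

end

(* The weighted energy x(t) . Q^i x(t), with i the active mode, decays at rate at least
   2 min_i lambda^i along each flow by the Lyapunov inequalities, and gamma11 <= 1 says exactly
   that it does not increase at the jumps. So it decays exponentially whatever the event times,
   and Q^i >= I turns this into exponential decay of x.

   For the existence of the square roots, write Q = c (I - E) with |E| < 1 for large c: the root
   is sqrt c (I - Y), where Y is the fixed point of the contraction Y |-> (E + Y^2) / 2. For
   uniqueness, two roots B and C with difference D = B - C satisfy B D + D C = 0, and the traces of
   D B D and D C D are nonnegative with sum zero. *)

theory Submission
  imports Defs
begin

section \<open>Quadratic forms and the Loewner order\<close>

lemma inner_matrix_vector_mult:
  fixes M :: "real^'n::finite^'m::finite"
  shows "x \<bullet> (M *v y) = (transpose M *v x) \<bullet> y"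
  by (metis dot_lmul_matrix transpose_matrix_vector)

lemma psd_matrixI:
  fixes M :: "real^'n::finite^'n"
  assumes "\<And>x y. x \<bullet> (M *v y) = (M *v x) \<bullet> y" "\<And>x. 0 \<le> x \<bullet> (M *v x)"
  shows "psd_matrix M"
proof -
  have "transpose M *v x = M *v x" for x
    by (metis assms(1) inner_matrix_vector_mult vector_eq_rdot)
  then show ?thesis
    using assms(2) by (auto simp: psd_matrix_def symmetric_matrix_def matrix_eq)
qed

lemma loewner_le_inner:
  assumes "loewner_le M N"
  shows "x \<bullet> (M *v x) \<le> x \<bullet> (N *v x)"
  using assms unfolding loewner_le_def psd_matrix_def
  by (simp add: matrix_vector_mult_diff_rdistrib inner_diff_right)

lemma norm_le_loewner:
  assumes "loewner_le (mat 1) M"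
  shows "(norm x)\<^sup>2 \<le> x \<bullet> (M *v x)"
  using loewner_le_inner[OF assms, of x] by (simp add: power2_norm_eq_inner)

section \<open>Square roots of symmetric matrices above the identity\<close>

text \<open>The last property says \<open>(I - Y)^2 = I - E\<close>. Banach's fixed point theorem is
  applied on the self-adjoint maps of norm at most \<open>r\<close>; bounded linear maps replace
  matrices because their norm is the operator norm, in which \<open>E\<close> will be small.\<close>

lemma blinfun_sqrt_fixpoint:
  fixes E :: "'a::euclidean_space \<Rightarrow>\<^sub>L 'a"
  assumes sym: "\<And>x y. E x \<bullet> y = x \<bullet> E y" and nE: "norm E \<le> r" and r: "r < 1"
  obtains Y :: "'a \<Rightarrow>\<^sub>L 'a" where "norm Y \<le> r"
    "\<And>x y. blinfun_apply Y x \<bullet> y = x \<bullet> blinfun_apply Y y"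
    "\<And>x. 2 *\<^sub>R blinfun_apply Y x = E x + blinfun_apply Y (blinfun_apply Y x)"
proof -
  define s where "s = {Y :: 'a \<Rightarrow>\<^sub>L 'a. norm Y \<le> r \<and>
    (\<forall>x y. blinfun_apply Y x \<bullet> y = x \<bullet> blinfun_apply Y y)}"
  define f where "f Y = (1/2) *\<^sub>R (E + (Y o\<^sub>L Y))" for Y
  have r0: "0 \<le> r" using nE norm_ge_zero order_trans by blast
  have "closed s"
    unfolding s_def
    by (intro closed_Collect_conj closed_Collect_all closed_Collect_le closed_Collect_eq
        continuous_intros)
  then have "complete s" by (simp add: complete_eq_closed)
  moreover have "s \<noteq> {}" using nE sym by (auto simp: s_def)
  moreover have "f ` s \<subseteq> s"
  proof safe
    fix Y assume Y: "Y \<in> s"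
    have "norm (E + (Y o\<^sub>L Y)) \<le> r + r * r"
      using Y nE r0
      by (intro norm_triangle_mono order_trans[OF norm_blinfun_compose] mult_mono)
        (auto simp: s_def)
    \<comment> \<open>Hence \<open>f Y\<close> has norm at most \<open>(r + r * r) / 2\<close>,
      which is at most \<open>r\<close>.\<close>
    moreover have "r * r \<le> r"
      using r r0 by (simp add: mult_left_le)
    ultimately show "f Y \<in> s"
      using Y sym by (simp add: s_def f_def blinfun.bilinear_simps inner_add_left inner_add_right)
  qed
  moreover have "\<forall>Y\<in>s. \<forall>Z\<in>s. dist (f Y) (f Z) \<le> r * dist Y Z"
  proof safe
    fix Y Z assume Y: "Y \<in> s" and Z: "Z \<in> s"
    \<comment> \<open>A difference of squares, split so that \<open>Y\<close> and \<open>Z\<close>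
      need not commute. Each summand contributes a factor \<open>r\<close>, and the
      \<open>1/2\<close> leaves the contraction constant \<open>r\<close>.\<close>
    have eq: "f Y - f Z = (1/2) *\<^sub>R ((Y o\<^sub>L (Y - Z)) + ((Y - Z) o\<^sub>L Z))"
      by (rule blinfun_eqI) (simp add: f_def blinfun.bilinear_simps algebra_simps)
    have "norm ((Y o\<^sub>L (Y - Z)) + ((Y - Z) o\<^sub>L Z)) \<le> r * norm (Y - Z) + norm (Y - Z) * r"
      using Y Z r0
      by (intro norm_triangle_mono order_trans[OF norm_blinfun_compose] mult_mono)
        (auto simp: s_def)
    then show "dist (f Y) (f Z) \<le> r * dist Y Z"
      by (simp add: dist_norm eq)
  qed
  ultimately obtain Y where Y: "Y \<in> s" "f Y = Y"
    using Banach_fix[of s r f] r r0 by blast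
  show thesis
  proof (rule that)
    have "2 *\<^sub>R Y = E + (Y o\<^sub>L Y)"
      by (subst (1) Y(2)[symmetric]) (simp add: f_def)
    then show "2 *\<^sub>R Y x = E x + Y (Y x)" for x
      by (metis blinfun.add_left blinfun.scaleR_left blinfun_apply_blinfun_compose)
  qed (use Y(1) in \<open>auto simp: s_def\<close>)
qed

text \<open>Besides existence, the strict positivity of the root is recorded: the uniqueness
  argument needs it for one of the two roots.\<close>

lemma posdef_sqrt_exists:
  fixes Q :: "real^'n::finite^'n"
  assumes sym: "symmetric_matrix Q" and ge: "loewner_le (mat 1) Q"
  obtains B where "psd_matrix B" "B ** B = Q" "\<And>x. x \<noteq> 0 \<Longrightarrow> 0 < x \<bullet> (B *v x)"
proof -
  define q where "q = Blinfun ((*v) Q)"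
  have q: "blinfun_apply q = (*v) Q"
    by (simp add: q_def bounded_linear_Blinfun_apply)
  \<comment> \<open>With \<open>c\<close> at least the squared norm of \<open>Q\<close>, the term
    \<open>|Q x|^2 / c^2\<close> is at most \<open>|x|^2 / c\<close>, while \<open>Q\<close> above
    the identity makes the cross term \<open>2 (x . Q x) / c\<close> at least
    \<open>2 |x|^2 / c\<close>. So \<open>|E x|^2\<close> is at most \<open>(1 - 1/c) |x|^2\<close>,
    which dictates \<open>r\<close>. The added 1 keeps \<open>c\<close> positive and
    \<open>1 - 1/c\<close> nonnegative.\<close>
  define c where "c = (norm q)\<^sup>2 + 1"
  define r where "r = sqrt (1 - 1 / c)"
  define E where "E = id_blinfun - (1/c) *\<^sub>R q"
  have c: "c \<ge> 1" by (simp add: c_def)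
  have r: "r < 1" "0 \<le> r" "r\<^sup>2 = 1 - 1 / c" using c by (auto simp: r_def)
  have E: "E x = x - (1/c) *\<^sub>R (Q *v x)" for x
    by (simp add: E_def q blinfun.bilinear_simps)
  have Qsym: "(Q *v x) \<bullet> y = x \<bullet> (Q *v y)" for x y
    using sym by (simp add: inner_matrix_vector_mult symmetric_matrix_def)
  have nE: "norm E \<le> r"
  proof (rule norm_blinfun_bound[OF r(2)])
    fix x
    have "norm (Q *v x) \<le> norm q * norm x"
      by (metis norm_blinfun q)
    then have "(norm (Q *v x))\<^sup>2 \<le> (norm q)\<^sup>2 * (norm x)\<^sup>2"
      by (metis norm_ge_zero power_mono power_mult_distrib)
    also have "\<dots> \<le> c * (norm x)\<^sup>2"
      by (simp add: c_def mult_right_mono)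
    finally have *: "(norm (Q *v x))\<^sup>2 / c\<^sup>2 \<le> (norm x)\<^sup>2 / c"
      using c by (simp add: field_simps power2_eq_square)
    have **: "(norm x)\<^sup>2 / c \<le> x \<bullet> (Q *v x) / c"
      using c norm_le_loewner[OF ge, of x] by (simp add: divide_right_mono)
    have "(norm (E x))\<^sup>2 = (norm x)\<^sup>2 - 2 * (x \<bullet> (Q *v x) / c) + (norm (Q *v x))\<^sup>2 / c\<^sup>2"
      unfolding E power2_norm_eq_inner
      by (simp add: inner_diff_left inner_diff_right inner_commute power2_eq_square algebra_simps)
    also have "\<dots> \<le> (norm x)\<^sup>2 - (norm x)\<^sup>2 / c"
      using * ** by linarith
    also have "\<dots> = (r * norm x)\<^sup>2"
      by (simp add: power_mult_distrib r algebra_simps)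
    finally show "norm (E x) \<le> r * norm x"
      by (rule power2_le_imp_le) (use r(2) in simp)
  qed
  have Esym: "E x \<bullet> y = x \<bullet> E y" for x y
    by (simp add: E inner_diff_left inner_diff_right Qsym)
  obtain Y :: "(real^'n) \<Rightarrow>\<^sub>L (real^'n)" where Y: "norm Y \<le> r"
    "\<And>x y. blinfun_apply Y x \<bullet> y = x \<bullet> blinfun_apply Y y"
    "\<And>x. 2 *\<^sub>R blinfun_apply Y x = E x + blinfun_apply Y (blinfun_apply Y x)"
    by (rule blinfun_sqrt_fixpoint[OF Esym nE r(1)]) blast
  define g where "g x = sqrt c *\<^sub>R (x - Y x)" for x
  define B where "B = matrix g"
  have lin: "linear g"
    by (rule linearI) (simp_all add: g_def blinfun.bilinear_simps algebra_simps)
  have B: "B *v x = g x" for x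
    unfolding B_def using lin by (simp add: matrix_works)
  have pos: "0 < x \<bullet> (B *v x)" if "x \<noteq> 0" for x
  proof -
    \<comment> \<open>Since \<open>Y\<close> has norm at most \<open>r < 1\<close>, the form of
      \<open>I - Y\<close> is strictly positive.\<close>
    have "x \<bullet> Y x \<le> norm x * norm (Y x)" by (rule norm_cauchy_schwarz)
    also have "\<dots> \<le> norm x * (r * norm x)"
      by (meson Y(1) mult_left_mono mult_right_mono norm_blinfun norm_ge_zero order_trans)
    also have "\<dots> < norm x * norm x"
      using that r by simp
    finally have "x \<bullet> Y x < x \<bullet> x" by (simp flip: power2_norm_eq_inner add: power2_eq_square)
    then show ?thesis using c by (simp add: B g_def inner_diff_right)
  qed
  show thesis
  proof (rule that)
    show "psd_matrix B"
    proof (rule psd_matrixI)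
      show "0 \<le> x \<bullet> (B *v x)" for x
        using pos[of x] by (cases "x = 0") auto
    qed (simp add: B g_def inner_diff_left inner_diff_right Y(2))
    show "B ** B = Q"
    proof -
      have "g (g x) = Q *v x" for x
      proof -
        have "g (g x) = c *\<^sub>R (x - 2 *\<^sub>R Y x + Y (Y x))"
          using c by (simp add: g_def blinfun.bilinear_simps algebra_simps scaleR_2)
        also have "\<dots> = c *\<^sub>R (x - E x)" by (simp add: Y(3))
        also have "\<dots> = Q *v x" using c by (simp add: E)
        finally show ?thesis .
      qed
      then show ?thesis
        by (simp add: matrix_eq B flip: matrix_vector_mul_assoc)
    qed
  qed (rule pos)
qed

text \<open>Once both traces vanish, the strict positivity of \<open>B\<close> forces every column
  of \<open>B - C\<close> to be zero.\<close>

lemma psd_sqrt_unique: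
  fixes B C :: "real^'n::finite^'n"
  assumes B: "psd_matrix B" "\<And>x. x \<noteq> 0 \<Longrightarrow> 0 < x \<bullet> (B *v x)"
    and C: "psd_matrix C" and eq: "C ** C = B ** B"
  shows "C = B"
proof -
  define D where "D = B - C"
  have D: "transpose D = D"
    using B(1) C by (simp add: D_def psd_matrix_def symmetric_matrix_def transpose_def vec_eq_iff)
  \<comment> \<open>By the symmetry of \<open>D\<close>, this trace sums the quadratic form of
    \<open>M\<close> over the columns of \<open>D\<close>, so its sign is that of the form.\<close>
  have tr: "trace (D ** (M ** D)) = (\<Sum>i\<in>UNIV. (D *v axis i 1) \<bullet> (M *v (D *v axis i 1)))"
    for M :: "real^'n^'n"
  proof -
    have "X $ i $ i = axis i 1 \<bullet> (X *v axis i 1)" for X :: "real^'n^'n" and i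
      by (simp add: inner_axis' matrix_vector_mult_basis column_def)
    then have "(D ** (M ** D)) $ i $ i = axis i 1 \<bullet> (D *v (M *v (D *v axis i 1)))" for i
      by (simp add: matrix_vector_mul_assoc)
    then have "(D ** (M ** D)) $ i $ i = (D *v axis i 1) \<bullet> (M *v (D *v axis i 1))" for i
      by (simp only: inner_matrix_vector_mult[of _ D] D)
    then show ?thesis by (simp add: trace_def)
  qed
  have eq': "C *v (C *v x) = B *v (B *v x)" for x
    by (simp add: matrix_vector_mul_assoc eq)
  have "B ** D + D ** C = 0"
    by (simp add: D_def matrix_eq matrix_vector_mult_add_rdistrib matrix_vector_mult_diff_rdistrib
        matrix_vector_mult_diff_distrib eq' flip: matrix_vector_mul_assoc)
  then have "0 = trace (D ** (B ** D + D ** C))" by (simp add: trace_def)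
  \<comment> \<open>Cyclicity of the trace turns \<open>D D C\<close> into
    \<open>D C D\<close>.\<close>
  also have "\<dots> = trace (D ** (B ** D)) + trace (D ** (C ** D))"
    by (metis matrix_add_ldistrib trace_add matrix_mul_assoc trace_mul_sym)
  finally have sum0: "trace (D ** (B ** D)) + trace (D ** (C ** D)) = 0" by simp
  have nn: "0 \<le> x \<bullet> (B *v x)" "0 \<le> x \<bullet> (C *v x)" for x
    using B(1) C by (auto simp: psd_matrix_def)
  then have "trace (D ** (B ** D)) \<ge> 0" "trace (D ** (C ** D)) \<ge> 0"
    unfolding tr by (auto intro: sum_nonneg)
  with sum0 have "trace (D ** (B ** D)) = 0" by linarith
  then have "\<forall>i. (D *v axis i 1) \<bullet> (B *v (D *v axis i 1)) = 0"
    unfolding tr using nn by (subst (asm) sum_nonneg_eq_0_iff) auto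
  then have "\<forall>i. D *v axis i 1 = 0" using B(2) less_irrefl by metis
  then have "D = 0" by (simp add: matrix_vector_mult_basis column_def vec_eq_iff)
  then show ?thesis by (simp add: D_def)
qed

text \<open>Existence and uniqueness together justify the definite description in
  \<open>psd_sqrt\<close>.\<close>

lemma psd_sqrt:
  fixes Q :: "real^'n::finite^'n"
  assumes "symmetric_matrix Q" "loewner_le (mat 1) Q"
  shows "psd_matrix (psd_sqrt Q)" "psd_sqrt Q ** psd_sqrt Q = Q"
proof -
  obtain B where B: "psd_matrix B" "B ** B = Q" "\<And>x. x \<noteq> 0 \<Longrightarrow> 0 < x \<bullet> (B *v x)"
    using posdef_sqrt_exists[OF assms] by blast
  have "psd_sqrt Q = B"
    unfolding psd_sqrt_def using B psd_sqrt_unique by (intro the_equality) auto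
  with B show "psd_matrix (psd_sqrt Q)" "psd_sqrt Q ** psd_sqrt Q = Q" by auto
qed

text \<open>Expresses the energy as a Euclidean norm, so that bounds on spectral norms can compare
  energies.\<close>

lemma norm_psd_sqrt:
  fixes Q :: "real^'n::finite^'n"
  assumes "symmetric_matrix Q" "loewner_le (mat 1) Q"
  shows "(norm (psd_sqrt Q *v x))\<^sup>2 = x \<bullet> (Q *v x)"
proof -
  have "x \<bullet> (Q *v x) = x \<bullet> (psd_sqrt Q *v (psd_sqrt Q *v x))"
    by (simp add: matrix_vector_mul_assoc psd_sqrt[OF assms])
  also have "\<dots> = (psd_sqrt Q *v x) \<bullet> (psd_sqrt Q *v x)"
    using psd_sqrt(1)[OF assms]
    by (subst inner_matrix_vector_mult) (simp add: psd_matrix_def symmetric_matrix_def)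
  finally show ?thesis by (simp add: power2_norm_eq_inner)
qed

lemma invertible_psd_sqrt:
  fixes Q :: "real^'n::finite^'n"
  assumes "symmetric_matrix Q" "loewner_le (mat 1) Q"
  shows "invertible (psd_sqrt Q)"
proof -
  have "x = 0" if "psd_sqrt Q *v x = 0" for x
    using norm_psd_sqrt[OF assms, of x] norm_le_loewner[OF assms(2), of x] that by simp
  then show ?thesis
    using invertible_left_inverse matrix_left_invertible_ker by blast
qed

lemma matrix_inv_mult_left:
  assumes "invertible M"
  shows "matrix_inv M ** M = mat 1"
  using someI_ex[OF assms[unfolded invertible_def]] by (simp add: matrix_inv_def)

section \<open>Energy across jumps and along flows\<close>

text \<open>In the coordinates given by the square roots of \<open>Q i\<close> and
  \<open>Q i'\<close>, the jump is the matrix \<open>N\<close>, whose spectral norm is one of those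
  under the maximum in \<open>gamma11\<close>.\<close>

lemma jump_inner_le:
  fixes Q :: "'i::finite \<Rightarrow> real^'x::finite^'x" and R :: "'i \<Rightarrow> 'j::finite \<Rightarrow> 'i \<Rightarrow> real^'x^'x"
  assumes sym: "\<And>i. symmetric_matrix (Q i)" and ge: "\<And>i. loewner_le (mat 1) (Q i)"
    and gamma: "gamma11 Q R \<le> 1"
  shows "(R i j i' *v l) \<bullet> (Q i' *v (R i j i' *v l)) \<le> l \<bullet> (Q i *v l)"
proof -
  define N where "N = psd_sqrt (Q i') ** R i j i' ** matrix_inv (psd_sqrt (Q i))"
  let ?S = "{spectral_norm (psd_sqrt (Q i') ** R i j i' ** matrix_inv (psd_sqrt (Q i))) | i j i'. True}"
  \<comment> \<open>As a union over finite types the set is visibly finite, as \<open>Max_ge\<close>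
    requires.\<close>
  have "?S = (\<Union>i j i'. {spectral_norm (psd_sqrt (Q i') ** R i j i' ** matrix_inv (psd_sqrt (Q i)))})"
    by blast
  then have "finite ?S" by simp
  then have "spectral_norm N \<le> gamma11 Q R"
    unfolding gamma11_def N_def by (rule Max_ge) blast
  then have N1: "onorm ((*v) N) \<le> 1" using gamma by (simp add: spectral_norm_def)
  have "N ** psd_sqrt (Q i) = psd_sqrt (Q i') ** R i j i'"
    using matrix_inv_mult_left[OF invertible_psd_sqrt[OF sym ge]]
    by (simp add: N_def flip: matrix_mul_assoc)
  then have "norm (psd_sqrt (Q i') *v (R i j i' *v l)) = norm (N *v (psd_sqrt (Q i) *v l))"
    by (simp add: matrix_vector_mul_assoc)
  also have "\<dots> \<le> onorm ((*v) N) * norm (psd_sqrt (Q i) *v l)"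
    by (simp add: onorm)
  also have "\<dots> \<le> norm (psd_sqrt (Q i) *v l)"
    using N1 by (simp add: mult_left_le_one_le onorm_pos_le)
  finally have "(norm (psd_sqrt (Q i') *v (R i j i' *v l)))\<^sup>2 \<le> (norm (psd_sqrt (Q i) *v l))\<^sup>2"
    by (rule power_mono) simp
  then show ?thesis by (simp add: norm_psd_sqrt[OF sym ge])
qed

text \<open>The factor \<open>exp (2 * mu * s)\<close> turns decay into monotonicity: by the
  Lyapunov inequality the weighted energy has a nonpositive derivative. Allowing any
  \<open>mu\<close> below \<open>lam\<close> lets one rate serve all modes.\<close>

lemma quadratic_lyapunov_decay:
  fixes Q F :: "real^'x::finite^'x"
  assumes sym: "symmetric_matrix Q" and ge: "loewner_le (mat 1) Q"
    and lyap: "loewner_le (transpose F ** Q + Q ** F) ((- 2 * lam) *\<^sub>R Q)"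
    and mu: "mu \<le> lam"
    and sol: "\<And>s. s \<in> {a..<b} \<Longrightarrow> (x has_vector_derivative F *v x s) (at s within {a..<b})"
    and s: "s \<in> {a..<b}"
  shows "exp (2 * mu * s) * (x s \<bullet> (Q *v x s)) \<le> exp (2 * mu * a) * (x a \<bullet> (Q *v x a))"
proof -
  define W where "W s = exp (2 * mu * s) * (x s \<bullet> (Q *v x s))" for s
  define W' where "W' s = exp (2 * mu * s) *
    (2 * mu * (x s \<bullet> (Q *v x s)) + (x s \<bullet> (Q *v (F *v x s)) + (F *v x s) \<bullet> (Q *v x s)))" for s
  have deriv: "(W has_derivative (\<lambda>h. h * W' u)) (at u within {a..s})" if u: "u \<in> {a..s}" for u
  proof -
    \<comment> \<open>The mean value theorem needs a closed interval; \<open>{a..s}\<close> stays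
      clear of \<open>b\<close>, where the solution may jump.\<close>
    have "(x has_vector_derivative F *v x u) (at u within {a..s})"
      using s u by (intro has_vector_derivative_within_subset[OF sol]) auto
    then have x: "(x has_derivative (\<lambda>h. h *\<^sub>R (F *v x u))) (at u within {a..s})"
      by (simp add: has_vector_derivative_def)
    have Qx: "((\<lambda>s. Q *v x s) has_derivative (\<lambda>h. Q *v (h *\<^sub>R (F *v x u)))) (at u within {a..s})"
      using bounded_linear.has_derivative[OF matrix_vector_mul_bounded_linear x] .
    show ?thesis
      unfolding W_def W'_def
      by (rule has_derivative_eq_rhs, rule has_derivative_mult[OF _ has_derivative_inner[OF x Qx]])
        (auto intro!: derivative_eq_intros simp: fun_eq_iff algebra_simps matrix_vector_mult_scaleR)
  qed
  have neg: "W' u \<le> 0" for u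
  proof -
    let ?v = "x u"
    have "?v \<bullet> (Q *v (F *v ?v)) + (F *v ?v) \<bullet> (Q *v ?v) = ?v \<bullet> ((transpose F ** Q + Q ** F) *v ?v)"
      by (simp add: matrix_vector_mult_add_rdistrib inner_add_right inner_matrix_vector_mult[of _ "transpose F"]
          flip: matrix_vector_mul_assoc del: transpose_matrix_vector)
    also have "\<dots> \<le> - 2 * lam * (?v \<bullet> (Q *v ?v))"
      using loewner_le_inner[OF lyap, of ?v]
      unfolding scaleR_matrix_vector_assoc[symmetric] inner_scaleR_right .
    \<comment> \<open>Weakening the rate relies on the energy being nonnegative, which follows from
      \<open>Q\<close> above the identity.\<close>
    also have "\<dots> \<le> - 2 * mu * (?v \<bullet> (Q *v ?v))"
      using norm_le_loewner[OF ge, of ?v] mu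
      by (intro mult_right_mono) (auto intro: order_trans[OF zero_le_power2])
    finally show ?thesis by (auto simp: W'_def mult_le_0_iff)
  qed
  obtain u where "u \<in> {a..s}" "W s - W a = (s - a) * W' u"
    using mvt_very_simple[of a s W "\<lambda>u h. h * W' u"] deriv s by auto
  moreover have "(s - a) * W' u \<le> 0"
    using neg s by (intro mult_nonneg_nonpos) auto
  ultimately show ?thesis by (simp add: W_def)
qed

text \<open>Unboundedness rules out events accumulating at a finite time, so the intervals cover the
  half line.\<close>

lemma event_interval:
  assumes "event_times t" "\<not> bdd_above (range t)" "0 \<le> s"
  obtains k where "s \<in> {t k..<t (Suc k)}"
proof -
  have "\<exists>k. s < t k"
    using assms(2) by (meson bdd_aboveI2 not_le)
  define m where "m = (LEAST k. s < t k)"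
  have m: "s < t m" unfolding m_def using \<open>\<exists>k. s < t k\<close> by (rule LeastI_ex)
  \<comment> \<open>Here \<open>t 0 = 0\<close> and \<open>0 \<le> s\<close> enter; the wanted
    interval ends at \<open>t m\<close>.\<close>
  then have "m \<noteq> 0" using assms by (metis event_times_def not_less)
  then obtain k where k: "m = Suc k" by (meson not0_implies_Suc)
  have "\<not> s < t k" using not_less_Least[of k "\<lambda>k. s < t k"] k m_def by simp
  with m k show thesis by (intro that[of k]) auto
qed

text \<open>The weighted energy \<open>W k\<close> of the active mode never exceeds its initial
  value, so the bound does not depend on the number of events before \<open>s\<close>.\<close>

lemma switched_solution_decay:
  fixes F Q :: "'i::finite \<Rightarrow> real^'x::finite^'x" and R :: "'i \<Rightarrow> 'j::finite \<Rightarrow> 'i \<Rightarrow> real^'x^'x"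
  assumes sym: "\<And>i. symmetric_matrix (Q i)" and ge: "\<And>i. loewner_le (mat 1) (Q i)"
    and lyap: "\<And>i. loewner_le (transpose (F i) ** Q i + Q i ** F i) ((- 2 * lam i) *\<^sub>R Q i)"
    and gamma: "gamma11 Q R \<le> 1"
    and mu: "\<And>i. mu \<le> lam i"
    and t: "event_times t" "\<not> bdd_above (range t)"
    and sol: "switched_solution F R t \<sigma> \<nu> x" and s: "0 \<le> s"
  shows "exp (2 * mu * s) * (norm (x s))\<^sup>2 \<le> x 0 \<bullet> (Q (\<sigma> 0) *v x 0)"
proof -
  define W where "W k s = exp (2 * mu * s) * (x s \<bullet> (Q (\<sigma> k) *v x s))" for k s
  have flow: "W k s \<le> W k (t k)" if "s \<in> {t k..<t (Suc k)}" for k s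
    unfolding W_def using sol that
    by (intro quadratic_lyapunov_decay[OF sym ge lyap mu, of "t k" "t (Suc k)"])
      (auto simp: switched_solution_def)
  have jump: "W (Suc k) (t (Suc k)) \<le> W k (t k)" for k
  proof -
    let ?b = "t (Suc k)"
    obtain l where l: "(x \<longlongrightarrow> l) (at_left ?b)" "x ?b = R (\<sigma> k) (\<nu> (Suc k)) (\<sigma> (Suc k)) *v l"
      using sol unfolding switched_solution_def by (metis One_nat_def diff_Suc_1 le_add1 plus_1_eq_Suc)
    have "((\<lambda>s. Q (\<sigma> k) *v x s) \<longlongrightarrow> Q (\<sigma> k) *v l) (at_left ?b)"
      using bounded_linear.tendsto[OF matrix_vector_mul_bounded_linear l(1)] .
    \<comment> \<open>The flow bound holds only before \<open>?b\<close>, where \<open>x\<close>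
      already has its value after the jump. Passing to the left limit \<open>l\<close> bounds the
      energy just before the jump, still measured by the old mode.\<close>
    then have "(W k \<longlongrightarrow> exp (2 * mu * ?b) * (l \<bullet> (Q (\<sigma> k) *v l))) (at_left ?b)"
      unfolding W_def by (intro tendsto_intros l(1))
    moreover have "t k < ?b" using t(1) by (simp add: event_times_def strict_mono_Suc_iff)
    then have "\<forall>\<^sub>F s in at_left ?b. W k s \<le> W k (t k)"
      using flow by (auto simp: eventually_at_left intro: exI[of _ "t k"])
    ultimately have "exp (2 * mu * ?b) * (l \<bullet> (Q (\<sigma> k) *v l)) \<le> W k (t k)"
      by (intro tendsto_upperbound) auto
    moreover have "W (Suc k) ?b \<le> exp (2 * mu * ?b) * (l \<bullet> (Q (\<sigma> k) *v l))"
      unfolding W_def l(2) using jump_inner_le[OF sym ge gamma] by (intro mult_left_mono) auto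
    ultimately show ?thesis by linarith
  qed
  have start: "W k (t k) \<le> W 0 (t 0)" for k
    by (induction k) (use jump order_trans in blast)+
  obtain k where k: "s \<in> {t k..<t (Suc k)}" using event_interval[OF t s] .
  have "exp (2 * mu * s) * (norm (x s))\<^sup>2 \<le> W k s"
    unfolding W_def using norm_le_loewner[OF ge] by (intro mult_left_mono) auto
  also have "\<dots> \<le> W 0 (t 0)" using flow[OF k] start order_trans by blast
  finally show ?thesis using t(1) by (simp add: W_def event_times_def)
qed

section \<open>From exponential decay to asymptotic stability\<close>

text \<open>As \<open>K\<close> and \<open>mu\<close> are common to all of \<open>X\<close>,
  \<open>\<rho> / K\<close> serves as the stability radius; attraction follows by comparison with
  the exponential.\<close>

lemma exponentially_stable_imp_globally_asymptotically_stable: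
  assumes mu: "0 < mu" and K: "0 < K"
    and decay: "\<And>x s. x \<in> X \<Longrightarrow> 0 \<le> s \<Longrightarrow> norm (x s) \<le> K * norm (x 0) * exp (- mu * s)"
  shows "globally_asymptotically_stable X"
  unfolding globally_asymptotically_stable_def
proof (intro conjI allI impI ballI)
  fix \<rho> :: real assume \<rho>: "0 < \<rho>"
  show "\<exists>\<delta>>0. \<forall>x\<in>X. norm (x 0) < \<delta> \<longrightarrow> (\<forall>s\<ge>0. norm (x s) < \<rho>)"
  proof (intro exI[of _ "\<rho> / K"] conjI ballI impI allI)
    fix x and s :: real assume x: "x \<in> X" "norm (x 0) < \<rho> / K" and s: "0 \<le> s"
    have "norm (x s) \<le> K * norm (x 0) * exp (- mu * s)" by (rule decay[OF x(1) s])
    also have "\<dots> \<le> K * norm (x 0)"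
      using mu s K by (intro mult_left_le) auto
    also have "\<dots> < \<rho>" using x(2) K by (simp add: field_simps)
    finally show "norm (x s) < \<rho>" .
  qed (use \<rho> K in simp)
next
  fix x assume x: "x \<in> X"
  have "LIM s at_top. - mu * s :> at_bot"
    using mu by (intro filterlim_tendsto_neg_mult_at_bot[OF tendsto_const _ filterlim_ident]) simp
  then have "((\<lambda>s. exp (- mu * s)) \<longlongrightarrow> 0) at_top"
    by (rule filterlim_compose[OF exp_at_bot])
  then have "((\<lambda>s. K * norm (x 0) * exp (- mu * s)) \<longlongrightarrow> 0) at_top"
    by (rule tendsto_mult_right_zero)
  moreover have "\<forall>\<^sub>F s in at_top. norm (x s) \<le> K * norm (x 0) * exp (- mu * s)"
    using eventually_ge_at_top[of 0] by eventually_elim (rule decay[OF x])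
  ultimately show "(x \<longlongrightarrow> 0) at_top" by (rule Lim_null_comparison[rotated])
qed

lemma switched_system_globally_asymptotically_stable:
  fixes F Q :: "'i::finite \<Rightarrow> real^'x::finite^'x" and R :: "'i \<Rightarrow> 'j::finite \<Rightarrow> 'i \<Rightarrow> real^'x^'x"
  assumes sym: "\<And>i. symmetric_matrix (Q i)" and ge: "\<And>i. loewner_le (mat 1) (Q i)"
    and lam: "\<And>i. 0 < lam i"
    and lyap: "\<And>i. loewner_le (transpose (F i) ** Q i + Q i ** F i) ((- 2 * lam i) *\<^sub>R Q i)"
    and gamma: "gamma11 Q R \<le> 1"
    and t: "event_times t" "\<not> bdd_above (range t)"
  shows "globally_asymptotically_stable {x. switched_solution F R t \<sigma> \<nu> x}"
proof -
  \<comment> \<open>A common rate, positive because there are finitely many modes.\<close>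
  define mu where "mu = Min (range lam)"
  have mu: "0 < mu" "\<And>i. mu \<le> lam i" using lam by (auto simp: mu_def)
  \<comment> \<open>Bounds the initial energy by \<open>K\<close> times the squared norm of
    \<open>x 0\<close>; the added 1 makes \<open>K\<close> positive at once.\<close>
  define K where "K = onorm ((*v) (Q (\<sigma> 0))) + 1"
  have K: "1 \<le> K" by (simp add: K_def onorm_pos_le)
  show ?thesis
  proof (rule exponentially_stable_imp_globally_asymptotically_stable[OF mu(1), of "sqrt K"])
    fix x and s :: real assume "x \<in> {x. switched_solution F R t \<sigma> \<nu> x}" and s: "0 \<le> s"
    then have "exp (2 * mu * s) * (norm (x s))\<^sup>2 \<le> x 0 \<bullet> (Q (\<sigma> 0) *v x 0)"
      using switched_solution_decay[OF sym ge lyap gamma mu(2) t] by blast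
    also have "\<dots> \<le> norm (x 0) * (onorm ((*v) (Q (\<sigma> 0))) * norm (x 0))"
      by (intro order_trans[OF norm_cauchy_schwarz] mult_left_mono onorm) auto
    also have "\<dots> \<le> K * (norm (x 0))\<^sup>2"
      by (simp add: K_def power2_eq_square algebra_simps)
    \<comment> \<open>Taking roots turns the energy rate \<open>2 * mu\<close> into the norm rate
      \<open>mu\<close>, and \<open>K\<close> into \<open>sqrt K\<close>.\<close>
    finally have "(exp (mu * s) * norm (x s))\<^sup>2 \<le> (sqrt K * norm (x 0))\<^sup>2"
      using K by (simp add: power_mult_distrib mult.assoc flip: exp_double)
    then have "exp (mu * s) * norm (x s) \<le> sqrt K * norm (x 0)"
      by (rule power2_le_imp_le) (use K in simp)
    then show "norm (x s) \<le> sqrt K * norm (x 0) * exp (- mu * s)"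
      by (simp add: exp_minus field_simps)
  qed (use K in simp)
qed

theorem proposition14:
  fixes eps :: real
    and D \<A> S A :: "'i::finite \<Rightarrow> real^('x::finite + 'z::finite)^('x + 'z)"
    and \<J> :: "'j::finite \<Rightarrow> real^('x + 'z)^('x + 'z)"
    and J :: "'i \<Rightarrow> 'j \<Rightarrow> 'i \<Rightarrow> real^('x + 'z)^('x + 'z)"
    and A0 Q :: "'i \<Rightarrow> real^'x^'x"
    and R :: "'i \<Rightarrow> 'j \<Rightarrow> 'i \<Rightarrow> real^'x^'x"
    and lam :: "'i \<Rightarrow> real"
  assumes "0 < eps"
    and "\<And>i. is_eps_diagonal eps (D i)"
    and "\<And>i. permutation_matrix (S i)"
    and "\<And>i. S i ** D i ** transpose (S i) = diag_matrix (case_sum (\<lambda>_. 1) (\<lambda>_. eps))"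
    and "\<And>i. A i = S i ** \<A> i ** transpose (S i)"
    and "\<And>i j i'. J i j i' = S i' ** \<J> j ** transpose (S i)"
    and "\<And>i. invertible (block22 (A i))"
    and "\<And>i. A0 i = reduced_flow (A i)"
    and "\<And>i j i'. R i j i' = reduced_jump (A i) (J i j i')"
    and "\<And>i. hurwitz (A0 i)"
    and "\<And>i. hurwitz (block22 (A i))"
    and "\<And>i. symmetric_matrix (Q i)"
    and "\<And>i. loewner_le (mat 1) (Q i)"
    and "\<And>i. 0 < lam i"
    and "\<And>i. loewner_le (transpose (A0 i) ** Q i + Q i ** A0 i) ((- 2 * lam i) *\<^sub>R Q i)"
    and "gamma11 Q R \<le> 1"
  shows "\<forall>t \<sigma> \<nu>. event_times t \<and> \<not> bdd_above (range t) \<longrightarrow>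
           globally_asymptotically_stable {x. switched_solution A0 R t \<sigma> \<nu> x}"
proof (intro allI impI, elim conjE)
  fix t \<sigma> \<nu>
  assume "event_times t" "\<not> bdd_above (range t)"
  then show "globally_asymptotically_stable {x. switched_solution A0 R t \<sigma> \<nu> x}"
    by (rule switched_system_globally_asymptotically_stable[OF assms(12-16)])
qed

end
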